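(* Let $m,n\in\mathbb{N}$ with $m\geq 2$. Let $A=\bigoplus_{j=1}^{m-1}A_j$ with $A_1,\ldots,A_{m-1}\in M_n$, and suppose $A$ is nonsingular. Let $B=[B_0\ B_1\ \cdots\ B_{m-1}]$ with $B_0,\ldots,B_{m-1}\in M_n$. Let $\mathcal{C}_{A,B}$ be the associated generalized companion matrix. (i) If $m\geq 3$ is odd, then $\frac{(m-1)n}{2}\leq d(\mathcal{C}_{A,B})\leq \frac{(m+1)n}{2}$. (ii) If $m\geq 2$ is even, then $d(\mathcal{C}_{A,B})=\frac{mn}{2}$.
   Context: $M_n$ is the set of $n\times n$ complex matrices. For $A=\bigoplus_{j=1}^{m-1}A_j$ (block diagonal) and $B=[B_0\ \cdots\ B_{m-1}]$ with all $A_j,B_j\in M_n$, the generalized companion matrix is the $mn\times mn$ matrix $$\mathcal{C}_{A,B}=\begin{bmatrix}0 & \bigoplus_{j=1}^{m-1}A_j\\ B_0 & [B_1\ \cdots\ B_{m-1}]\end{bmatrix},$$ i.e. viewed as an $m\times m$ matrix of $n\times n$ blocks, its $(j,j+1)$ block is $A_j$ for $1\le j\le m-1$, its last block row is $B_0,B_1,\ldots,B_{m-1}$, and all other blocks are $0$. The zero-dilation index $d(X)$ of a square complex matrix $X$ is the largest integer $k$ such that $X$ is unitarily similar to a matrix of the form $\begin{bmatrix}0_k & *\\ * & *\end{bmatrix}$, where $0_k$ is the $k\times k$ zero matrix ($k=0$ if there is no such positive $k$). *)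

theory Defs
  imports Complex_Main "Jordan_Normal_Form.Schur_Decomposition"
begin

definition block_row :: "nat \<Rightarrow> complex mat list \<Rightarrow> complex mat" where
  "block_row n Bs = mat n (length Bs * n) (\<lambda>(i, j). (Bs ! (j div n)) $$ (i, j mod n))"

(* Only A 1, ..., A (m - 1) and B 0, ..., B (m - 1) are used, each meant to be n x n. *)
definition gen_companion ::
  "nat \<Rightarrow> nat \<Rightarrow> (nat \<Rightarrow> complex mat) \<Rightarrow> (nat \<Rightarrow> complex mat) \<Rightarrow> complex mat" where
  "gen_companion m n A B =
     four_block_mat (0\<^sub>m ((m - 1) * n) n) (diag_block_mat (map A [1..<m]))
                    (B 0)                 (block_row n (map B [1..<m]))"

(* similar_mat_wit X Y U V says that X, Y, U, V are square of the same size,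
   U * V = V * U = 1 and X = U * Y * V; with V the conjugate transpose of U,
   the matrix U is unitary. *)
definition unitarily_similar :: "complex mat \<Rightarrow> complex mat \<Rightarrow> bool" where
  "unitarily_similar X Y \<longleftrightarrow> (\<exists>U. similar_mat_wit X Y U (mat_adjoint U))"

definition has_zero_block :: "complex mat \<Rightarrow> nat \<Rightarrow> bool" where
  "has_zero_block X k \<longleftrightarrow>
     (\<exists>r R S T. R \<in> carrier_mat k r \<and> S \<in> carrier_mat r k \<and> T \<in> carrier_mat r r \<and>
        unitarily_similar X (four_block_mat (0\<^sub>m k k) R S T))"

(* For square X this is the maximum of a finite set containing 0, by the two lemmas below. *)
definition zero_dilation_index :: "complex mat \<Rightarrow> nat" where
  "zero_dilation_index X = Max {k. has_zero_block X k}"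

lemma has_zero_block_le:
  assumes "has_zero_block X k"
  shows "k \<le> dim_row X"
proof -
  obtain r R S T U where T: "T \<in> carrier_mat r r"
    and w: "similar_mat_wit X (four_block_mat (0\<^sub>m k k) R S T) U (mat_adjoint U)"
    using assms unfolding has_zero_block_def unitarily_similar_def by blast
  have "four_block_mat (0\<^sub>m k k) R S T \<in> carrier_mat (dim_row X) (dim_row X)"
    using w unfolding similar_mat_wit_def Let_def by blast
  then have "k + r = dim_row X" using T by auto
  then show ?thesis by simp
qed

lemma finite_has_zero_block: "finite {k. has_zero_block X k}"
  by (rule finite_subset[of _ "{..dim_row X}"]) (auto dest: has_zero_block_le)

lemma has_zero_block_0:
  assumes X: "X \<in> carrier_mat N N"
  shows "has_zero_block X 0"
proof -
  have adj: "mat_adjoint (1\<^sub>m N :: complex mat) = 1\<^sub>m N"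
    by (rule eq_matI) (auto simp: mat_adjoint_def mat_of_rows_def)
  have "four_block_mat (0\<^sub>m 0 0) (0\<^sub>m 0 N) (0\<^sub>m N 0) X = X"
    using X by (intro eq_matI) auto
  moreover have "similar_mat_wit X X (1\<^sub>m N) (mat_adjoint (1\<^sub>m N))"
    unfolding adj similar_mat_wit_def Let_def using X by auto
  ultimately have "unitarily_similar X (four_block_mat (0\<^sub>m 0 0) (0\<^sub>m 0 N) (0\<^sub>m N 0) X)"
    unfolding unitarily_similar_def by metis
  then show ?thesis
    unfolding has_zero_block_def using X zero_carrier_mat by blast
qed

end

theory Submission
  imports Defs
begin

text \<open>The block indices \<open>1, 3, 5, \<dots>\<close> below \<open>m\<close> (counted from \<open>1\<close>) index a zero principal submatrix, which gives the lower bounds. For the upper bounds, a nonsingular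
  matrix of size \<open>N\<close> with a \<open>k \<times> k\<close> zero block satisfies \<open>2 k \<le> N\<close>. A zero block of the companion
  matrix \<open>C\<close> is also one of \<open>C + z C\<^sup>*\<close> and of any bordering of \<open>C\<close>. If \<open>m\<close> is even,
  sorting the block indices by parity puts \<open>C\<close> into the form \<open>[0 P; Q R]\<close> with square \<open>P = diag (A\<^sub>1, A\<^sub>3, \<dots>)\<close>,
  and \<open>C + z C\<^sup>*\<close> has off-diagonal blocks \<open>P + z Q\<^sup>*\<close> and, for \<open>|z| = 1\<close>, \<open>z (P + z Q\<^sup>*)\<^sup>*\<close>.
  As \<open>det (P + z Q\<^sup>*)\<close> is a polynomial in \<open>z\<close> that does not vanish at \<open>0\<close>, some unimodular \<open>z\<close> makes
  \<open>C + z C\<^sup>*\<close> nonsingular. In general, the kernel of \<open>A\<close> being trivial, \<open>C\<close> has corank at most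
  \<open>n\<close> and hence a nonsingular bordering of size \<open>m n + n\<close>.\<close>

section \<open>Adjoints and unitary similarity\<close>

lemma dim_mat_adjoint [simp]:
  "dim_row (mat_adjoint A) = dim_col A" "dim_col (mat_adjoint A) = dim_row A"
  by (auto simp: mat_adjoint_def)

lemma mat_adjoint_carrier [simp]:
  "A \<in> carrier_mat n m \<Longrightarrow> mat_adjoint A \<in> carrier_mat m n"
  by (intro carrier_matI) auto

lemma index_mat_adjoint [simp]:
  "i < dim_col A \<Longrightarrow> j < dim_row A \<Longrightarrow> mat_adjoint A $$ (i, j) = conjugate (A $$ (j, i))"
  by (simp add: mat_adjoint_def mat_of_rows_def)

lemma mat_adjoint_mat_adjoint [simp]: "mat_adjoint (mat_adjoint A) = A"
  by (intro eq_matI) auto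

lemma mat_adjoint_mult:
  fixes A B :: "complex mat"
  assumes "A \<in> carrier_mat n m" "B \<in> carrier_mat m l"
  shows "mat_adjoint (A * B) = mat_adjoint B * mat_adjoint A"
  by (rule eq_matI) (use assms in \<open>auto simp: scalar_prod_def intro!: sum.cong\<close>)

lemma det_mat_adjoint:
  fixes A :: "complex mat"
  assumes A: "A \<in> carrier_mat n n"
  shows "det (mat_adjoint A) = cnj (det A)"
proof -
  interpret comm_ring_hom cnj by unfold_locales auto
  have "mat_adjoint A = map_mat cnj (transpose_mat A)"
    by (rule eq_matI) auto
  then show ?thesis using det_transpose[OF A] by simp
qed

lemma mat_adjoint_four_block:
  fixes A :: "complex mat"
  assumes "A \<in> carrier_mat a c" "B \<in> carrier_mat a d" "C \<in> carrier_mat b c" "D \<in> carrier_mat b d"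
  shows "mat_adjoint (four_block_mat A B C D) =
    four_block_mat (mat_adjoint A) (mat_adjoint C) (mat_adjoint B) (mat_adjoint D)"
  by (rule eq_matI) (use assms in auto)

lemma mat_adjoint_zero: "mat_adjoint (0\<^sub>m a b :: complex mat) = 0\<^sub>m b a"
  by (rule eq_matI) auto

lemma mat_adjoint_one: "mat_adjoint (1\<^sub>m a :: complex mat) = 1\<^sub>m a"
  by (rule eq_matI) auto

section \<open>Zero blocks: entrywise form, determinant obstruction, pencils and borderings\<close>

text \<open>The other three blocks can be read off from \<open>Y\<close>, so only vanishing entries
  have to be tracked. The bound \<open>k \<le> N\<close> is stated separately because entries
  outside the dimensions of \<open>Y\<close> carry no information.\<close>

lemma has_zero_block_iff:
  assumes X: "X \<in> carrier_mat N N"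
  shows "has_zero_block X k \<longleftrightarrow>
    (\<exists>Y. unitarily_similar X Y \<and> k \<le> N \<and> (\<forall>i<k. \<forall>j<k. Y $$ (i, j) = 0))"
proof
  assume zb: "has_zero_block X k"
  then obtain r R S T where c: "R \<in> carrier_mat k r" "S \<in> carrier_mat r k" "T \<in> carrier_mat r r"
    and u: "unitarily_similar X (four_block_mat (0\<^sub>m k k) R S T)"
    unfolding has_zero_block_def by blast
  have "\<forall>i<k. \<forall>j<k. four_block_mat (0\<^sub>m k k) R S T $$ (i, j) = 0"
    using c by auto
  then show "\<exists>Y. unitarily_similar X Y \<and> k \<le> N \<and> (\<forall>i<k. \<forall>j<k. Y $$ (i, j) = 0)"
    using u has_zero_block_le[OF zb] X by auto
next
  assume "\<exists>Y. unitarily_similar X Y \<and> k \<le> N \<and> (\<forall>i<k. \<forall>j<k. Y $$ (i, j) = 0)"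
  then obtain Y where u: "unitarily_similar X Y" and k: "k \<le> N"
    and 0: "\<And>i j. i < k \<Longrightarrow> j < k \<Longrightarrow> Y $$ (i, j) = 0" by blast
  have Y: "Y \<in> carrier_mat N N"
    using u similar_mat_witD2[OF X] unfolding unitarily_similar_def by blast
  let ?R = "mat k (N - k) (\<lambda>(i, j). Y $$ (i, k + j))"
  let ?S = "mat (N - k) k (\<lambda>(i, j). Y $$ (k + i, j))"
  let ?T = "mat (N - k) (N - k) (\<lambda>(i, j). Y $$ (k + i, k + j))"
  have "Y = four_block_mat (0\<^sub>m k k) ?R ?S ?T"
    by (rule eq_matI) (use Y k 0 in auto)
  then show "has_zero_block X k"
    unfolding has_zero_block_def using u
    by (intro exI[of _ "N - k"] exI[of _ ?R] exI[of _ ?S] exI[of _ ?T]) auto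
qed

text \<open>The determinant has no nonzero term: a permutation would have to inject the \<open>k\<close> rows of
  the zero block into the remaining \<open>N - k\<close> columns.\<close>
lemma det_zero_block:
  fixes Y :: "'a :: idom mat"
  assumes Y: "Y \<in> carrier_mat N N" and k: "k \<le> N" "N < 2 * k"
    and 0: "\<And>i j. i < k \<Longrightarrow> j < k \<Longrightarrow> Y $$ (i, j) = 0"
  shows "det Y = 0"
proof -
  have "(\<Prod>i = 0..<N. Y $$ (i, p i)) = 0" if p: "p permutes {0..<N}" for p
  proof -
    have "\<exists>i<k. p i < k"
    proof (rule ccontr)
      assume *: "\<not> (\<exists>i<k. p i < k)"
      have "p ` {0..<k} \<subseteq> {k..<N}"
      proof
        fix y assume "y \<in> p ` {0..<k}"
        then obtain i where i: "i < k" "y = p i" by auto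
        then have "p i \<in> {0..<N}" using permutes_in_image[OF p] k by auto
        then show "y \<in> {k..<N}" using * i by auto
      qed
      then have "card (p ` {0..<k}) \<le> N - k"
        using card_mono[of "{k..<N}"] by fastforce
      moreover have "card (p ` {0..<k}) = k"
        using card_image[of p "{0..<k}"] permutes_inj_on[OF p] by simp
      ultimately show False using k by linarith
    qed
    then obtain i where "i < k" "Y $$ (i, p i) = 0" using 0 by blast
    then show ?thesis using k by (intro prod_zero) auto
  qed
  then show ?thesis unfolding det_def using Y by (auto intro!: sum.neutral)
qed

text \<open>Similarity preserves the determinant, so \<open>det_zero_block\<close> passes from
  \<open>Y\<close> to \<open>X\<close>. Both upper bounds come from applying this to a nonsingular
  matrix built from the companion matrix.\<close>

lemma has_zero_block_det_nonzero:
  assumes X: "X \<in> carrier_mat N N" and zb: "has_zero_block X k" and det: "det X \<noteq> 0"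
  shows "2 * k \<le> N"
proof (rule ccontr)
  assume k: "\<not> 2 * k \<le> N"
  obtain Y where u: "unitarily_similar X Y" and kN: "k \<le> N"
    and 0: "\<forall>i<k. \<forall>j<k. Y $$ (i, j) = 0" using zb has_zero_block_iff[OF X] by blast
  obtain U where w: "similar_mat_wit X Y U (mat_adjoint U)"
    using u unfolding unitarily_similar_def by blast
  have "det Y = 0"
    using det_zero_block[of Y N k] similar_mat_witD2(5)[OF X w] kN 0 k by auto
  moreover have "det X = det Y"
    using w by (intro det_similar) (auto simp: similar_mat_def)
  ultimately show False using det by simp
qed

text \<open>As \<open>U\<close> is unitary, taking adjoints shows that the adjoints of
  \<open>X\<close> and \<open>Y\<close> are similar through the same \<open>U\<close>; hence so are
  the linear combinations.\<close>

lemma unitarily_similar_add_smult_adjoint: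
  assumes X: "X \<in> carrier_mat N N" and u: "unitarily_similar X Y"
  shows "unitarily_similar (X + z \<cdot>\<^sub>m mat_adjoint X) (Y + z \<cdot>\<^sub>m mat_adjoint Y)"
proof -
  obtain U where w: "similar_mat_wit X Y U (mat_adjoint U)"
    using u unfolding unitarily_similar_def by blast
  note D = similar_mat_witD2[OF X w]
  note [simp] = D(5-6)
  have [simp]: "U * Y \<in> carrier_mat N N" by (rule mult_carrier_mat[of _ N N]) auto
  have "mat_adjoint X = U * mat_adjoint Y * mat_adjoint U"
    by (subst D(3), subst mat_adjoint_mult[of _ N N _ N])
      (auto simp: mat_adjoint_mult[of _ N N _ N] assoc_mult_mat[of _ N N _ N _ N])
  moreover have [simp]: "U * mat_adjoint Y \<in> carrier_mat N N"
    by (rule mult_carrier_mat[of _ N N]) auto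
  ultimately have "X + z \<cdot>\<^sub>m mat_adjoint X = U * (Y + z \<cdot>\<^sub>m mat_adjoint Y) * mat_adjoint U"
    by (subst D(3)) (simp add: mult_add_distrib_mat[of _ N N _ N] add_mult_distrib_mat[of _ N N _ _ N]
        mult_smult_distrib[of _ N N _ N] mult_smult_assoc_mat[of _ N N _ N])
  then have "similar_mat_wit (X + z \<cdot>\<^sub>m mat_adjoint X) (Y + z \<cdot>\<^sub>m mat_adjoint Y) U (mat_adjoint U)"
    by (rule similar_mat_witI[OF D(1,2)]) (use X in simp_all)
  then show ?thesis unfolding unitarily_similar_def by blast
qed

text \<open>Entry \<open>(i, j)\<close> of the pencil in \<open>Y\<close> involves only
  \<open>Y $$ (i, j)\<close> and the conjugate of \<open>Y $$ (j, i)\<close>, and both lie in the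
  zero block.\<close>

lemma has_zero_block_add_smult_adjoint:
  assumes X: "X \<in> carrier_mat N N" and zb: "has_zero_block X k"
  shows "has_zero_block (X + z \<cdot>\<^sub>m mat_adjoint X) k"
proof -
  obtain Y where u: "unitarily_similar X Y" and k: "k \<le> N"
    and 0: "\<forall>i<k. \<forall>j<k. Y $$ (i, j) = 0" using zb has_zero_block_iff[OF X] by blast
  have Y: "Y \<in> carrier_mat N N"
    using u similar_mat_witD2[OF X] unfolding unitarily_similar_def by blast
  have "(Y + z \<cdot>\<^sub>m mat_adjoint Y) $$ (i, j) = 0" if "i < k" "j < k" for i j
    using that 0 k Y by auto
  moreover have "X + z \<cdot>\<^sub>m mat_adjoint X \<in> carrier_mat N N" using X by auto
  ultimately show ?thesis
    using unitarily_similar_add_smult_adjoint[OF X u] k has_zero_block_iff by blast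
qed

text \<open>If \<open>U\<close> carries \<open>Y\<close> to \<open>X\<close>, then the direct sum of
  \<open>U\<close> and \<open>1\<^sub>m r\<close> is unitary and carries a bordering of
  \<open>Y\<close> to the given bordering of \<open>X\<close>. The zero block of \<open>Y\<close>
  stays in the leading position.\<close>

lemma has_zero_block_bordered:
  assumes X: "X \<in> carrier_mat N N" and zb: "has_zero_block X k"
    and E: "E \<in> carrier_mat N r" and F: "F \<in> carrier_mat r N" and W: "W \<in> carrier_mat r r"
  shows "has_zero_block (four_block_mat X E F W) k"
proof -
  obtain Y where u: "unitarily_similar X Y" and k: "k \<le> N"
    and 0: "\<forall>i<k. \<forall>j<k. Y $$ (i, j) = 0" using zb has_zero_block_iff[OF X] by blast
  obtain U where w: "similar_mat_wit X Y U (mat_adjoint U)"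
    using u unfolding unitarily_similar_def by blast
  note D = similar_mat_witD2[OF X w]
  note [simp] = D(5-6) E F W
  let ?V = "four_block_mat U (0\<^sub>m N r) (0\<^sub>m r N) (1\<^sub>m r)"
  \<comment> \<open>The borders are chosen so that conjugation by \<open>?V\<close> cancels the
    factors \<open>U\<close> and its adjoint and returns exactly \<open>E\<close> and
    \<open>F\<close>.\<close>
  let ?Y = "four_block_mat Y (mat_adjoint U * E) (F * U) W"
  have V: "mat_adjoint ?V = four_block_mat (mat_adjoint U) (0\<^sub>m N r) (0\<^sub>m r N) (1\<^sub>m r)"
    by (simp add: mat_adjoint_four_block[of _ N N _ r _ r] mat_adjoint_zero mat_adjoint_one)
  have one: "1\<^sub>m (N + r) = four_block_mat (1\<^sub>m N) (0\<^sub>m N r) (0\<^sub>m r N) (1\<^sub>m r :: complex mat)"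
    by (rule eq_matI) auto
  have UE: "U * (mat_adjoint U * E) = E"
    by (subst assoc_mult_mat[symmetric, of _ N N _ N _ r]) (auto simp: D(1) left_mult_one_mat[OF E])
  have FU: "F * U * mat_adjoint U = F"
    by (subst assoc_mult_mat[of _ r N _ N _ N]) (auto simp: D(1) right_mult_one_mat[OF F])
  have c [simp]: "mat_adjoint U * E \<in> carrier_mat N r" "F * U \<in> carrier_mat r N"
    "U * Y \<in> carrier_mat N N"
    by (rule mult_carrier_mat[of _ _ N], simp_all)+
  have "similar_mat_wit (four_block_mat X E F W) ?Y ?V (mat_adjoint ?V)"
  proof (rule similar_mat_witI[of _ _ "N + r"])
    show "?V * mat_adjoint ?V = 1\<^sub>m (N + r)" "mat_adjoint ?V * ?V = 1\<^sub>m (N + r)"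
      unfolding V one
      by (subst mult_four_block_mat[of _ N N _ r _ r _ _ N _ r],
          simp_all add: D(1,2) right_mult_zero_mat[of _ N N] left_mult_zero_mat[of _ N N])+
    have "?V * ?Y = four_block_mat (U * Y) E (F * U) W"
      by (subst mult_four_block_mat[of _ N N _ r _ r _ _ N _ r]) (simp_all add: UE
          left_mult_zero_mat[OF D(5)] left_mult_zero_mat[OF W] left_mult_zero_mat[OF c(1)]
          left_mult_zero_mat[OF c(2)] left_mult_one_mat[OF c(2)] left_mult_one_mat[OF W])
    then show "four_block_mat X E F W = ?V * ?Y * mat_adjoint ?V"
      unfolding V
      by simp (subst mult_four_block_mat[of _ N N _ r _ r _ _ N _ r],
          simp_all add: D(3)[symmetric] FU X right_mult_zero_mat[OF E] right_mult_zero_mat[OF W]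
          right_mult_zero_mat[OF c(2)] right_mult_zero_mat[OF c(3)]
          right_mult_one_mat[OF E] right_mult_one_mat[OF W] right_add_zero_mat[OF X])
  qed (use X in simp_all)
  moreover have "?Y $$ (i, j) = 0" if "i < k" "j < k" for i j
    using that 0 less_le_trans[OF that(1) k] less_le_trans[OF that(2) k]
    by (simp add: carrier_matD[OF D(5)] carrier_matD[OF W])
  moreover have "four_block_mat X E F W \<in> carrier_mat (N + r) (N + r)" using X by simp
  note has_zero_block_iff[OF this, of k]
  ultimately show ?thesis
    using k unfolding unitarily_similar_def by (meson trans_le_add1)
qed

section \<open>Permutation similarity and zero principal submatrices\<close>

lemma unitarily_similar_reindex:
  assumes X: "X \<in> carrier_mat N N" and p: "bij_betw p {..<N} {..<N}"
  shows "unitarily_similar X (mat N N (\<lambda>(i, j). X $$ (p i, p j)))"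
proof -
  \<comment> \<open>The permutation matrix whose column \<open>j\<close> is the unit vector at
    \<open>p j\<close>.\<close>
  define U :: "complex mat" where "U = mat N N (\<lambda>(i, j). if i = p j then 1 else 0)"
  let ?Y = "mat N N (\<lambda>(i, j). X $$ (p i, p j))"
  have U [simp]: "U \<in> carrier_mat N N" by (simp add: U_def)
  have pN: "p i < N" if "i < N" for i using p that by (auto simp: bij_betw_def)
  have pinj: "p i = p j \<longleftrightarrow> i = j" if "i < N" "j < N" for i j
    using p that by (auto simp: bij_betw_def inj_on_def)
  have adj: "mat_adjoint U * U = 1\<^sub>m N"
  proof (rule eq_matI)
    fix i j assume ij: "i < dim_row (1\<^sub>m N :: complex mat)" "j < dim_col (1\<^sub>m N :: complex mat)"
    then have "(mat_adjoint U * U) $$ (i, j) = (\<Sum>c = 0..<N. cnj (U $$ (c, i)) * U $$ (c, j))"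
      using carrier_matD[OF U] by (simp add: scalar_prod_def)
    also have "\<dots> = (\<Sum>c = 0..<N. if c = p i then (if p i = p j then 1 else 0) else 0)"
      using ij by (intro sum.cong) (auto simp: U_def)
    finally show "(mat_adjoint U * U) $$ (i, j) = 1\<^sub>m N $$ (i, j)"
      using ij pN pinj by (simp add: sum.delta)
  qed (use carrier_matD[OF U] in auto)
  then have adj': "U * mat_adjoint U = 1\<^sub>m N"
    by (rule mat_mult_left_right_inverse[rotated 2]) simp_all
  have "X * U = U * ?Y"
  proof (rule eq_matI)
    fix i j assume "i < dim_row (U * ?Y)" "j < dim_col (U * ?Y)"
    then have ij: "i < N" "j < N" by (auto simp: U_def)
    \<comment> \<open>By surjectivity of \<open>p\<close>, row \<open>i\<close> of \<open>U\<close>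
      has its single entry 1 in column \<open>c\<close>, which collapses the sum for
      \<open>U * ?Y\<close>.\<close>
    obtain c where c: "c < N" "i = p c"
      using p ij by (metis bij_betw_iff_bijections lessThan_iff)
    have "(X * U) $$ (i, j) = (\<Sum>a = 0..<N. X $$ (i, a) * U $$ (a, j))"
      using ij X carrier_matD[OF U] by (simp add: scalar_prod_def)
    also have "\<dots> = (\<Sum>a = 0..<N. if a = p j then X $$ (i, a) else 0)"
      using ij by (intro sum.cong) (auto simp: U_def)
    also have "\<dots> = X $$ (i, p j)" using pN ij by simp
    also have "\<dots> = (\<Sum>a = 0..<N. if a = c then X $$ (p a, p j) else 0)" using c by simp
    also have "\<dots> = (\<Sum>a = 0..<N. U $$ (i, a) * X $$ (p a, p j))"
      using ij c pinj by (intro sum.cong) (auto simp: U_def)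
    also have "\<dots> = (U * ?Y) $$ (i, j)"
      using ij carrier_matD[OF U] by (simp add: scalar_prod_def)
    finally show "(X * U) $$ (i, j) = (U * ?Y) $$ (i, j)" .
  qed (use X carrier_matD[OF U] in auto)
  then have "U * ?Y * mat_adjoint U = X * U * mat_adjoint U" by simp
  also have "\<dots> = X"
    using X by (subst assoc_mult_mat[of _ N N _ N _ N]) (auto simp: adj')
  finally show ?thesis
    unfolding unitarily_similar_def
    by (intro exI[of _ U] similar_mat_witI[of _ _ N]) (use X adj adj' in auto)
qed

text \<open>A permutation that moves \<open>J\<close> to the front turns the zero principal
  submatrix into a leading one.\<close>

lemma has_zero_block_principal:
  assumes X: "X \<in> carrier_mat N N" and J: "J \<subseteq> {..<N}"
    and 0: "\<And>i j. i \<in> J \<Longrightarrow> j \<in> J \<Longrightarrow> X $$ (i, j) = 0"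
  shows "has_zero_block X (card J)"
proof -
  have fin: "finite J" using J finite_subset by blast
  have kN: "card J \<le> N" using card_mono[OF _ J] by simp
  obtain f where f: "bij_betw f {..<card J} J"
    using finite_same_card_bij[of "{..<card J}" J] fin by auto
  \<comment> \<open>The complements have equal size, so \<open>f\<close> extends to a permutation of
    all indices.\<close>
  have "card ({..<N} - {..<card J}) = card ({..<N} - J)"
    using fin J kN by (subst (1 2) card_Diff_subset) auto
  then obtain g where g: "bij_betw g ({..<N} - {..<card J}) ({..<N} - J)"
    using finite_same_card_bij[of "{..<N} - {..<card J}" "{..<N} - J"] by auto
  define p where "p = (\<lambda>i. if i \<in> {..<card J} then f i else g i)"
  have "bij_betw p ({..<card J} \<union> ({..<N} - {..<card J})) (J \<union> ({..<N} - J))"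
    unfolding p_def by (rule bij_betw_disjoint_Un[OF f g]) auto
  moreover have "{..<card J} \<union> ({..<N} - {..<card J}) = {..<N}" "J \<union> ({..<N} - J) = {..<N}"
    using J kN by auto
  ultimately have "bij_betw p {..<N} {..<N}" by metis
  then have "unitarily_similar X (mat N N (\<lambda>(i, j). X $$ (p i, p j)))"
    by (rule unitarily_similar_reindex[OF X])
  moreover have "p i \<in> J" if "i < card J" for i
    using f that by (auto simp: p_def bij_betw_def)
  ultimately show ?thesis
    unfolding has_zero_block_iff[OF X] using kN 0
    by (intro exI[of _ "mat N N (\<lambda>(i, j). X $$ (p i, p j))"]) auto
qed

section \<open>Determinants of pencils and block matrices\<close>

text \<open>The determinant of the pencil is a polynomial in \<open>z\<close> with value
  \<open>det P\<close> at 0. A nonzero polynomial has finitely many roots and cannot vanish on the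
  whole unit circle.\<close>

lemma exists_unit_det_pencil_nonzero:
  fixes P Q :: "complex mat"
  assumes P: "P \<in> carrier_mat h h" and Q: "Q \<in> carrier_mat h h" and det: "det P \<noteq> 0"
  obtains z where "z * cnj z = 1" "det (P + z \<cdot>\<^sub>m Q) \<noteq> 0"
proof -
  define p where "p = det (mat h h (\<lambda>ij. [:P $$ ij, Q $$ ij:]))"
  have p: "poly p z = det (P + z \<cdot>\<^sub>m Q)" for z
  proof -
    have "map_mat (\<lambda>q. poly q z) (mat h h (\<lambda>ij. [:P $$ ij, Q $$ ij:])) = P + z \<cdot>\<^sub>m Q"
      by (rule eq_matI) (use P Q in auto)
    then show ?thesis unfolding p_def by (metis comm_ring_hom.hom_det[OF poly_hom.comm_ring_hom_axioms])
  qed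
  have "P + 0 \<cdot>\<^sub>m Q = P" by (rule eq_matI) (use P Q in auto)
  then have p0: "p \<noteq> 0" using p[of 0] det by auto
  \<comment> \<open>There is one more root of unity of order \<open>Suc (degree p)\<close> than
    \<open>p\<close> can have roots.\<close>
  have "\<not> {z. z ^ Suc (degree p) = 1} \<subseteq> {z. poly p z = 0}"
  proof
    assume "{z. z ^ Suc (degree p) = 1} \<subseteq> {z. poly p z = 0}"
    then have "card {z :: complex. z ^ Suc (degree p) = 1} \<le> card {z. poly p z = 0}"
      using poly_roots_finite[OF p0] by (rule card_mono[rotated])
    then show False
      using card_poly_roots_bound[OF p0] card_roots_unity_eq[of "Suc (degree p)"] by simp
  qed
  then obtain z where z: "z ^ Suc (degree p) = 1" "poly p z \<noteq> 0" by auto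
  have "norm z ^ Suc (degree p) = 1" using z(1) by (metis norm_one norm_power)
  then have "norm z = 1" using power_eq_imp_eq_base[of "norm z" "Suc (degree p)" 1] by simp
  then have "z * cnj z = 1" by (simp add: complex_norm_square[symmetric])
  then show ?thesis using that z(2) p by simp
qed

text \<open>Swapping the two block columns by \<open>?S\<close> gives a block lower triangular
  matrix with diagonal blocks \<open>P\<close> and \<open>Q\<close>.\<close>

lemma det_four_block_mat_upper_left_zero_nonzero:
  fixes P :: "complex mat"
  assumes P: "P \<in> carrier_mat h h" and Q: "Q \<in> carrier_mat h h" and R: "R \<in> carrier_mat h h"
    and det: "det P \<noteq> 0" "det Q \<noteq> 0"
  shows "det (four_block_mat (0\<^sub>m h h) P Q R) \<noteq> 0"
proof -
  let ?M = "four_block_mat (0\<^sub>m h h) P Q R"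
  let ?S = "four_block_mat (0\<^sub>m h h) (1\<^sub>m h) (1\<^sub>m h) (0\<^sub>m h h) :: complex mat"
  have "?M * ?S = four_block_mat P (0\<^sub>m h h) R Q"
    using P Q R by (subst mult_four_block_mat[of _ h h _ h _ h _ _ h _ h]) auto
  then have "det (?M * ?S) = det P * det Q"
    using det_four_block_mat_upper_right_zero[OF P refl R Q] by simp
  moreover have "det (?M * ?S) = det ?M * det ?S"
    using R by (intro det_mult[of _ "h + h"]) auto
  ultimately show ?thesis using det by auto
qed

lemma invertible_mat_det_nonzero:
  fixes A :: "'a :: idom mat"
  assumes "invertible_mat A" shows "det A \<noteq> 0"
proof -
  obtain B where sq: "square_mat A" and B: "inverts_mat A B" "inverts_mat B A"
    using assms unfolding invertible_mat_def by blast
  let ?n = "dim_row A"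
  have A: "A \<in> carrier_mat ?n ?n" using sq by auto
  have AB: "A * B = 1\<^sub>m ?n" using B(1) by (simp add: inverts_mat_def)
  have BA: "B * A = 1\<^sub>m (dim_row B)" using B(2) by (simp add: inverts_mat_def)
  \<comment> \<open>\<open>inverts_mat\<close> does not fix the shape of \<open>B\<close>; counting
    columns in the two products does.\<close>
  have "dim_col B = ?n" using arg_cong[OF AB, of dim_col] by simp
  moreover have "dim_row B = ?n" using arg_cong[OF BA, of dim_col] carrier_matD(2)[OF A] by simp
  ultimately have "B \<in> carrier_mat ?n ?n" by auto
  then have "det A * det B = 1" using det_mult[OF A] AB by (metis det_one)
  then show ?thesis by auto
qed

section \<open>Block diagonal matrices\<close>

lemma diag_block_mat_carrier:
  assumes "\<And>A. A \<in> set As \<Longrightarrow> A \<in> carrier_mat n n"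
  shows "diag_block_mat As \<in> carrier_mat (length As * n) (length As * n)"
  using assms by (induction As) (auto simp: Let_def)

lemma det_diag_block_mat:
  fixes As :: "'a :: idom mat list"
  assumes "\<And>A. A \<in> set As \<Longrightarrow> A \<in> carrier_mat n n"
  shows "det (diag_block_mat As) = (\<Prod>A\<leftarrow>As. det A)"
  using assms
proof (induction As)
  case (Cons A As)
  have D: "diag_block_mat As \<in> carrier_mat (length As * n) (length As * n)"
    using Cons.prems by (intro diag_block_mat_carrier) auto
  have A: "A \<in> carrier_mat n n" using Cons.prems by simp
  have "det (four_block_mat A (0\<^sub>m n (length As * n)) (0\<^sub>m (length As * n) n) (diag_block_mat As)) =
      det A * det (diag_block_mat As)"
    using A D by (intro det_four_block_mat_upper_right_zero) auto
  then show ?case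
    using Cons D by (simp add: Let_def carrier_matD[OF A] carrier_matD[OF D])
qed simp

lemma index_diag_block_mat:
  assumes "\<And>A. A \<in> set As \<Longrightarrow> A \<in> carrier_mat n n" "i < length As * n" "j < length As * n"
  shows "diag_block_mat As $$ (i, j) =
    (if i div n = j div n then (As ! (i div n)) $$ (i mod n, j mod n) else 0)"
  using assms
proof (induction As arbitrary: i j)
  case (Cons A As)
  have n: "n > 0" using Cons.prems(2) by (cases n) auto
  have D: "diag_block_mat As \<in> carrier_mat (length As * n) (length As * n)"
    using Cons.prems by (intro diag_block_mat_carrier) auto
  have A: "A \<in> carrier_mat n n" using Cons.prems by auto
  have ix: "diag_block_mat (A # As) $$ (i, j) =
      (if i < n then if j < n then A $$ (i, j) else 0
       else if j < n then 0 else diag_block_mat As $$ (i - n, j - n))"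
    using D A Cons.prems(2,3) by (auto simp: Let_def)
  show ?case
  proof (cases "i < n \<or> j < n")
    case True
    then show ?thesis using ix n by (auto simp: div_eq_0_iff)
  next
    case False
    \<comment> \<open>Past the first block, subtracting \<open>n\<close> from both indices lowers
      the block numbers by one and keeps the residues.\<close>
    then have "diag_block_mat As $$ (i - n, j - n) =
        (if (i - n) div n = (j - n) div n
         then (As ! ((i - n) div n)) $$ ((i - n) mod n, (j - n) mod n) else 0)"
      using Cons.prems by (intro Cons.IH) auto
    then show ?thesis using ix False n by (auto simp: le_div_geq le_mod_geq)
  qed
qed simp

section \<open>Nonsingular pencils and borderings\<close>

text \<open>If \<open>Q\<close> is singular, so is \<open>X\<close>, and the determinant criterion
  does not apply to \<open>X\<close> itself. A suitable pencil of \<open>X\<close> with its adjoint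
  is nonsingular and keeps the zero block.\<close>

lemma has_zero_block_le_half:
  assumes X: "X \<in> carrier_mat (2 * h) (2 * h)"
    and P: "P \<in> carrier_mat h h" and Q: "Q \<in> carrier_mat h h" and R: "R \<in> carrier_mat h h"
    and u: "unitarily_similar X (four_block_mat (0\<^sub>m h h) P Q R)"
    and det: "det P \<noteq> 0" and zb: "has_zero_block X k"
  shows "k \<le> h"
proof -
  let ?Y = "four_block_mat (0\<^sub>m h h) P Q R"
  obtain z where z: "z * cnj z = 1" and dP: "det (P + z \<cdot>\<^sub>m mat_adjoint Q) \<noteq> 0"
    using exists_unit_det_pencil_nonzero[OF P _ det, of "mat_adjoint Q"] Q by auto
  \<comment> \<open>Since \<open>z\<close> is unimodular, the lower left block of the pencil is a
    multiple of the adjoint of the upper right one, so a single determinant controls both.\<close>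
  have "Q + z \<cdot>\<^sub>m mat_adjoint P = z \<cdot>\<^sub>m mat_adjoint (P + z \<cdot>\<^sub>m mat_adjoint Q)"
  proof (rule eq_matI)
    fix i j assume "i < dim_row (z \<cdot>\<^sub>m mat_adjoint (P + z \<cdot>\<^sub>m mat_adjoint Q))"
      "j < dim_col (z \<cdot>\<^sub>m mat_adjoint (P + z \<cdot>\<^sub>m mat_adjoint Q))"
    then have ij: "i < h" "j < h" using P Q by auto
    have "Q $$ (i, j) = (z * cnj z) * Q $$ (i, j)" using z by simp
    then show "(Q + z \<cdot>\<^sub>m mat_adjoint P) $$ (i, j) =
        (z \<cdot>\<^sub>m mat_adjoint (P + z \<cdot>\<^sub>m mat_adjoint Q)) $$ (i, j)"
      using ij P Q by (simp add: algebra_simps)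
  qed (use P Q in auto)
  then have dQ: "det (Q + z \<cdot>\<^sub>m mat_adjoint P) \<noteq> 0"
    using dP z P Q det_mat_adjoint[of "P + z \<cdot>\<^sub>m mat_adjoint Q" h] by auto
  have "?Y + z \<cdot>\<^sub>m mat_adjoint ?Y = four_block_mat (0\<^sub>m h h) (P + z \<cdot>\<^sub>m mat_adjoint Q)
      (Q + z \<cdot>\<^sub>m mat_adjoint P) (R + z \<cdot>\<^sub>m mat_adjoint R)"
    by (rule eq_matI) (use P Q R in auto)
  then have "det (?Y + z \<cdot>\<^sub>m mat_adjoint ?Y) \<noteq> 0"
    using det_four_block_mat_upper_left_zero_nonzero[OF _ _ _ dP dQ] P Q R by simp
  moreover have "det (X + z \<cdot>\<^sub>m mat_adjoint X) = det (?Y + z \<cdot>\<^sub>m mat_adjoint ?Y)"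
    using unitarily_similar_add_smult_adjoint[OF X u, of z]
    unfolding unitarily_similar_def by (intro det_similar) (unfold similar_mat_def, blast)
  ultimately have "det (X + z \<cdot>\<^sub>m mat_adjoint X) \<noteq> 0" by simp
  then have "2 * k \<le> 2 * h"
    using X has_zero_block_add_smult_adjoint[OF X zb]
    by (intro has_zero_block_det_nonzero[of "X + z \<cdot>\<^sub>m mat_adjoint X"]) auto
  then show ?thesis by simp
qed

text \<open>Take \<open>F\<close> to be the identity on the first \<open>n\<close> coordinates and
  \<open>E\<close> the identity into the last \<open>n\<close>. For a kernel vector
  \<open>(x, y, w)\<close>, the rows of \<open>F\<close> give \<open>x = 0\<close>, the rows of
  \<open>D\<close> then give \<open>D y = 0\<close> and so \<open>y = 0\<close>, and the remaining
  rows give \<open>w = 0\<close>.\<close>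

lemma exists_nonsingular_bordering:
  fixes D :: "complex mat"
  assumes D: "D \<in> carrier_mat l l" and B0: "B0 \<in> carrier_mat n n" and Br: "Br \<in> carrier_mat n l"
    and det: "det D \<noteq> 0"
  obtains E F where "E \<in> carrier_mat (l + n) n" "F \<in> carrier_mat n (l + n)"
    "det (four_block_mat (four_block_mat (0\<^sub>m l n) D B0 Br) E F (0\<^sub>m n n)) \<noteq> 0"
proof
  let ?C = "four_block_mat (0\<^sub>m l n) D B0 Br"
  let ?E = "mat (l + n) n (\<lambda>(i, j). if j + l = i then 1 else 0) :: complex mat"
  let ?F = "mat n (l + n) (\<lambda>(i, j). if j = i then 1 else 0) :: complex mat"
  show E: "?E \<in> carrier_mat (l + n) n" and F: "?F \<in> carrier_mat n (l + n)" by auto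
  have C: "?C \<in> carrier_mat (l + n) (l + n)"
    by (rule carrier_matI) (use D B0 Br in auto)
  let ?K = "four_block_mat ?C ?E ?F (0\<^sub>m n n)"
  have K: "?K \<in> carrier_mat (l + n + n) (l + n + n)" using C by auto
  have "v = 0\<^sub>v (l + n + n)" if v: "v \<in> carrier_vec (l + n + n)" and Kv: "?K *\<^sub>v v = 0\<^sub>v (l + n + n)" for v
  proof -
    \<comment> \<open>The lengths \<open>n\<close>, \<open>l\<close>, \<open>n\<close> follow the
      column partition of \<open>?C\<close> and its border.\<close>
    define x where "x = vec n (\<lambda>i. v $ i)"
    define y where "y = vec l (\<lambda>i. v $ (n + i))"
    define w where "w = vec n (\<lambda>i. v $ (n + l + i))"
    have [simp]: "x \<in> carrier_vec n" "y \<in> carrier_vec l" "w \<in> carrier_vec n"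
      by (auto simp: x_def y_def w_def)
    have xy: "x @\<^sub>v y \<in> carrier_vec (l + n)" by (rule carrier_vecI) (simp add: x_def y_def)
    have v_eq: "v = (x @\<^sub>v y) @\<^sub>v w"
      by (rule eq_vecI) (use v in \<open>auto simp: x_def y_def w_def add.commute\<close>)
    have Ew: "?E *\<^sub>v w = 0\<^sub>v l @\<^sub>v w"
    proof (rule eq_vecI)
      fix i assume "i < dim_vec (0\<^sub>v l @\<^sub>v w)"
      then have i: "i < l + n" by (simp add: w_def)
      have "(?E *\<^sub>v w) $ i = (\<Sum>j = 0..<n. if j + l = i then w $ j else 0)"
        using i by (auto simp: scalar_prod_def w_def intro!: sum.cong)
      also have "\<dots> = (\<Sum>j = 0..<n. if j = i - l then (if l \<le> i then w $ j else 0) else 0)"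
        using i by (intro sum.cong) auto
      finally show "(?E *\<^sub>v w) $ i = (0\<^sub>v l @\<^sub>v w) $ i"
        using i by (auto simp: w_def)
    qed (simp add: w_def)
    have Fxy: "?F *\<^sub>v (x @\<^sub>v y) = x"
    proof (rule eq_vecI)
      fix i assume "i < dim_vec x"
      then have i: "i < n" by (simp add: x_def)
      have "(?F *\<^sub>v (x @\<^sub>v y)) $ i = (\<Sum>j = 0..<l + n. ?F $$ (i, j) * (x @\<^sub>v y) $ j)"
        using i carrier_vecD[OF xy] by (simp add: scalar_prod_def del: index_append_vec)
      also have "\<dots> = (\<Sum>j = 0..<l + n. if j = i then (x @\<^sub>v y) $ j else 0)"
        using i by (intro sum.cong) auto
      finally have "(?F *\<^sub>v (x @\<^sub>v y)) $ i = (\<Sum>j = 0..<l + n. if j = i then (x @\<^sub>v y) $ j else 0)" .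
      then show "(?F *\<^sub>v (x @\<^sub>v y)) $ i = x $ i"
        using i by (simp add: x_def)
    qed (simp add: x_def)
    have "?K *\<^sub>v v = (?C *\<^sub>v (x @\<^sub>v y) + ?E *\<^sub>v w) @\<^sub>v (?F *\<^sub>v (x @\<^sub>v y) + 0\<^sub>m n n *\<^sub>v w)"
      unfolding v_eq by (rule four_block_mat_mult_vec[OF C E F _ xy]) auto
    moreover have "0\<^sub>v (l + n + n) = 0\<^sub>v (l + n) @\<^sub>v (0\<^sub>v n :: complex vec)" by (rule eq_vecI) auto
    ultimately have "(?C *\<^sub>v (x @\<^sub>v y) + ?E *\<^sub>v w) @\<^sub>v (?F *\<^sub>v (x @\<^sub>v y) + 0\<^sub>m n n *\<^sub>v w) =
        0\<^sub>v (l + n) @\<^sub>v 0\<^sub>v n" using Kv by simp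
    moreover have "?C *\<^sub>v (x @\<^sub>v y) + ?E *\<^sub>v w \<in> carrier_vec (l + n)"
      using C E by (intro add_carrier_vec mult_mat_vec_carrier[OF C xy] mult_mat_vec_carrier[OF E]) simp
    ultimately have 1: "?C *\<^sub>v (x @\<^sub>v y) + ?E *\<^sub>v w = 0\<^sub>v (l + n)"
      and 2: "?F *\<^sub>v (x @\<^sub>v y) + 0\<^sub>m n n *\<^sub>v w = 0\<^sub>v n"
      using append_vec_eq[OF _ zero_carrier_vec] by blast+
    have "0\<^sub>m n n *\<^sub>v w = 0\<^sub>v n" by (rule eq_vecI) (auto simp: w_def)
    then have x0: "x = 0\<^sub>v n" using 2 unfolding Fxy by simp
    have c: "D *\<^sub>v y \<in> carrier_vec l" "Br *\<^sub>v y \<in> carrier_vec n" using D Br by auto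
    have "?C *\<^sub>v (x @\<^sub>v y) = (0\<^sub>m l n *\<^sub>v x + D *\<^sub>v y) @\<^sub>v (B0 *\<^sub>v x + Br *\<^sub>v y)"
      by (rule four_block_mat_mult_vec[OF _ D B0 Br]) auto
    also have "0\<^sub>m l n *\<^sub>v x = 0\<^sub>v l" unfolding x0 by (rule eq_vecI) auto
    also have "B0 *\<^sub>v x = 0\<^sub>v n" unfolding x0 using B0 by (intro eq_vecI) auto
    finally have "?C *\<^sub>v (x @\<^sub>v y) + ?E *\<^sub>v w = (D *\<^sub>v y) @\<^sub>v (Br *\<^sub>v y + w)"
      using c unfolding Ew by (simp add: append_vec_add[of _ l _ _ n])
    moreover have "0\<^sub>v (l + n) = 0\<^sub>v l @\<^sub>v (0\<^sub>v n :: complex vec)" by (rule eq_vecI) auto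
    ultimately have "(D *\<^sub>v y) @\<^sub>v (Br *\<^sub>v y + w) = 0\<^sub>v l @\<^sub>v 0\<^sub>v n"
      using 1 by simp
    then have Dy: "D *\<^sub>v y = 0\<^sub>v l" and w: "Br *\<^sub>v y + w = 0\<^sub>v n"
      using append_vec_eq[OF c(1) zero_carrier_vec] by blast+
    have y0: "y = 0\<^sub>v l" 
      using det det_0_iff_vec_prod_zero[OF D] Dy \<open>y \<in> carrier_vec l\<close> by blast
    have "Br *\<^sub>v 0\<^sub>v l = 0\<^sub>v n" using Br by (intro eq_vecI) auto
    then have w0: "w = 0\<^sub>v n" using w unfolding y0 by simp
    show ?thesis unfolding v_eq x0 y0 w0 by (rule eq_vecI) auto
  qed
  then show "det ?K \<noteq> 0" using det_0_iff_vec_prod_zero[OF K] by blast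
qed

section \<open>Generalized companion matrices\<close>

lemma diag_block_mat_upt_carrier:
  assumes "\<And>j. 1 \<le> j \<Longrightarrow> j \<le> m - 1 \<Longrightarrow> A j \<in> carrier_mat n n"
  shows "diag_block_mat (map A [1..<m]) \<in> carrier_mat ((m - 1) * n) ((m - 1) * n)"
proof -
  have "X \<in> carrier_mat n n" if "X \<in> set (map A [1..<m])" for X using that assms by auto
  then have "diag_block_mat (map A [1..<m]) \<in>
      carrier_mat (length (map A [1..<m]) * n) (length (map A [1..<m]) * n)"
    by (rule diag_block_mat_carrier)
  then show ?thesis by simp
qed

lemma gen_companion_carrier:
  assumes m: "m \<ge> 1" and A: "\<And>j. 1 \<le> j \<Longrightarrow> j \<le> m - 1 \<Longrightarrow> A j \<in> carrier_mat n n"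
  shows "gen_companion m n A B \<in> carrier_mat (m * n) (m * n)"
proof -
  have "diag_block_mat (map A [1..<m]) \<in> carrier_mat ((m - 1) * n) ((m - 1) * n)"
    by (rule diag_block_mat_upt_carrier) (rule A)
  moreover have "m * n = (m - 1) * n + n" using m by (cases m) auto
  ultimately show ?thesis
    by (intro carrier_matI) (auto simp: gen_companion_def block_row_def)
qed

text \<open>Block indices are counted from 0 here, so block row \<open>r\<close> holds the matrix
  \<open>A (r + 1)\<close> in block column \<open>r + 1\<close>. The last block row, which holds the
  \<open>B j\<close>, is excluded.\<close>

lemma index_gen_companion:
  assumes m: "m \<ge> 1" and A: "\<And>j. 1 \<le> j \<Longrightarrow> j \<le> m - 1 \<Longrightarrow> A j \<in> carrier_mat n n"
    and B: "B 0 \<in> carrier_mat n n" and i: "i < (m - 1) * n" and j: "j < m * n"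
  shows "gen_companion m n A B $$ (i, j) =
    (if j div n = Suc (i div n) then A (j div n) $$ (i mod n, j mod n) else 0)"
proof -
  have n: "n > 0" using i by (cases n) auto
  have mn: "m * n = (m - 1) * n + n" using m by (cases m) auto
  let ?D = "diag_block_mat (map A [1..<m])"
  have D: "?D \<in> carrier_mat ((m - 1) * n) ((m - 1) * n)"
    by (rule diag_block_mat_upt_carrier) (rule A)
  have ix: "gen_companion m n A B $$ (i, j) = (if j < n then 0 else ?D $$ (i, j - n))"
    using i j mn D B by (simp add: gen_companion_def block_row_def)
  show ?thesis
  proof (cases "j < n")
    case True
    then show ?thesis using ix by simp
  next
    case False
    then have "?D $$ (i, j - n) = (if i div n = (j - n) div n
        then (map A [1..<m] ! (i div n)) $$ (i mod n, (j - n) mod n) else 0)"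
      using A i j mn by (intro index_diag_block_mat) auto
    moreover have "i div n < m - 1" using i n by (simp add: div_less_iff_less_mult)
    ultimately show ?thesis using ix False n by (auto simp: le_div_geq le_mod_geq)
  qed
qed

section \<open>Sorting block indices by parity\<close>

text \<open>Enumerates in order the scalar indices lying in blocks 0, 2, 4, ..., counted from 0;
  these are the blocks 1, 3, 5, ... when counted from 1.\<close>

definition even_index :: "nat \<Rightarrow> nat \<Rightarrow> nat" where
  "even_index n a = 2 * (a div n) * n + a mod n"

lemma even_index_div_mod [simp]:
  assumes "n > 0"
  shows "even_index n a div n = 2 * (a div n)" "even_index n a mod n = a mod n"
  using assms by (auto simp: even_index_def)

lemma inj_even_index:
  assumes "n > 0" shows "inj (even_index n)"
proof (rule injI)
  fix a b assume "even_index n a = even_index n b"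
  then have "2 * (a div n) = 2 * (b div n)" "a mod n = b mod n"
    using even_index_div_mod[OF assms] by metis+
  then show "a = b" by (metis div_mod_decomp mult_cancel1 zero_neq_numeral)
qed

text \<open>The summand \<open>n\<close> leaves room for the next, odd block: the same position
  there is still in range.\<close>

lemma even_index_less:
  assumes "a < h * n"
  shows "even_index n a + n < 2 * h * n"
proof -
  have n: "n > 0" using assms by (cases n) auto
  have "a div n + 1 \<le> h" using assms n by (simp add: div_less_iff_less_mult Suc_le_eq)
  then have "2 * (a div n + 1) * n \<le> 2 * h * n" by (intro mult_right_mono mult_left_mono) auto
  moreover have "a mod n < n" using n by simp
  ultimately show "even_index n a + n < 2 * h * n" by (simp add: even_index_def algebra_simps)
qed

text \<open>Above the last block row, nonzero entries join block \<open>r\<close> only to block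
  \<open>r + 1\<close>, which has the other parity. Hence the even blocks among them span a zero
  principal submatrix.\<close>

lemma has_zero_block_gen_companion:
  assumes m: "m \<ge> 1" and A: "\<And>j. 1 \<le> j \<Longrightarrow> j \<le> m - 1 \<Longrightarrow> A j \<in> carrier_mat n n"
    and B: "B 0 \<in> carrier_mat n n"
  shows "has_zero_block (gen_companion m n A B) (m div 2 * n)"
proof (cases "n = 0")
  case True
  then show ?thesis using has_zero_block_0[OF gen_companion_carrier[of m A n B, OF m A]] by simp
next
  case False
  let ?h = "m div 2 * n" and ?J = "even_index n ` {..<m div 2 * n}"
  \<comment> \<open>The blocks used are 0, 2, ..., \<open>2 * (m div 2) - 2\<close>, so the last
    block row is avoided even when \<open>m\<close> is odd and its number \<open>m - 1\<close> is
    even.\<close>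
  have less: "even_index n a < (m - 1) * n" if "a < ?h" for a
  proof -
    have "2 * (m div 2) * n \<le> m * n" by (intro mult_right_mono) auto
    then have "even_index n a + n < m * n" using even_index_less[OF that] by linarith
    then show ?thesis by (simp add: diff_mult_distrib)
  qed
  have le: "(m - 1) * n \<le> m * n" by simp
  have "?J \<subseteq> {..<m * n}" using less_le_trans[OF less le] by auto
  moreover have "gen_companion m n A B $$ (i, j) = 0" if ij: "i \<in> ?J" "j \<in> ?J" for i j
  proof -
    obtain a b where ab: "a < ?h" "i = even_index n a" "b < ?h" "j = even_index n b"
      using ij by blast
    have "even (i div n)" "even (j div n)" using ab False by auto
    then have "j div n \<noteq> Suc (i div n)" by auto
    moreover have "i < (m - 1) * n" "j < m * n"
      using ab less less_le_trans[OF less le] by auto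
    ultimately show ?thesis using index_gen_companion[of m A n B, OF m A B] by simp
  qed
  ultimately have "has_zero_block (gen_companion m n A B) (card ?J)"
    by (intro has_zero_block_principal[OF gen_companion_carrier[of m A n B, OF m A]]) auto
  moreover have "card ?J = ?h"
    using False inj_even_index by (subst card_image) (auto intro: inj_on_subset)
  ultimately show ?thesis by simp
qed

text \<open>Listing the even blocks before the odd ones puts the entries from even to odd blocks
  into the upper right corner, where exactly \<open>A 1\<close>, \<open>A 3\<close>, ... appear on
  the diagonal.\<close>

lemma unitarily_similar_gen_companion:
  assumes A: "\<And>j. 1 \<le> j \<Longrightarrow> j \<le> 2 * h - 1 \<Longrightarrow> A j \<in> carrier_mat n n"
    and B: "B 0 \<in> carrier_mat n n" and h: "h \<ge> 1"
  obtains Q R where "Q \<in> carrier_mat (h * n) (h * n)" "R \<in> carrier_mat (h * n) (h * n)"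
    "unitarily_similar (gen_companion (2 * h) n A B)
       (four_block_mat (0\<^sub>m (h * n) (h * n)) (diag_block_mat (map (\<lambda>q. A (Suc (2 * q))) [0..<h])) Q R)"
proof
  let ?C = "gen_companion (2 * h) n A B" and ?l = "h * n"
  let ?As = "map (\<lambda>q. A (Suc (2 * q))) [0..<h]"
  \<comment> \<open>The second half repeats the enumeration of the first, shifted by one
    block.\<close>
  define p where "p = (\<lambda>i. if i < ?l then even_index n i else even_index n (i - ?l) + n)"
  let ?Q = "mat ?l ?l (\<lambda>(i, j). ?C $$ (p (?l + i), p j))"
  let ?R = "mat ?l ?l (\<lambda>(i, j). ?C $$ (p (?l + i), p (?l + j)))"
  show "?Q \<in> carrier_mat ?l ?l" "?R \<in> carrier_mat ?l ?l" by auto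
  have C: "?C \<in> carrier_mat (2 * h * n) (2 * h * n)"
    using h A by (intro gen_companion_carrier) auto
  have pl: "p i < 2 * h * n" if "i < 2 * h * n" for i
    using that even_index_less[of i h n] even_index_less[of "i - ?l" h n]
    by (auto simp: p_def)
  have "inj_on p {..<2 * h * n}"
  proof (rule inj_onI)
    fix i j assume ij: "i \<in> {..<2 * h * n}" "j \<in> {..<2 * h * n}" "p i = p j"
    then have n: "n > 0" by (cases n) auto
    \<comment> \<open>The parity of the block number tells which half \<open>k\<close> comes
      from.\<close>
    have "even (p k div n) \<longleftrightarrow> k < ?l" for k using n by (auto simp: p_def)
    then have "i < ?l \<longleftrightarrow> j < ?l" using ij(3) by metis
    moreover have "i = j" if "even_index n i = even_index n j"
      using that injD[OF inj_even_index[OF n]] by blast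
    moreover have "i - ?l = j - ?l" if "even_index n (i - ?l) = even_index n (j - ?l)"
      using that injD[OF inj_even_index[OF n]] by blast
    ultimately show "i = j" using ij(3) by (auto simp: p_def split: if_splits)
  qed
  then have "bij_betw p {..<2 * h * n} {..<2 * h * n}"
    using pl endo_inj_surj[of "{..<2 * h * n}" p] by (auto simp: bij_betw_def)
  then have "unitarily_similar ?C (mat (2 * h * n) (2 * h * n) (\<lambda>(i, j). ?C $$ (p i, p j)))"
    by (rule unitarily_similar_reindex[OF C])
  moreover have "mat (2 * h * n) (2 * h * n) (\<lambda>(i, j). ?C $$ (p i, p j)) =
      four_block_mat (0\<^sub>m ?l ?l) (diag_block_mat ?As) ?Q ?R"
  proof -
    have D: "diag_block_mat ?As \<in> carrier_mat ?l ?l"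
      using diag_block_mat_carrier[of ?As n] A by fastforce
    have row: "?C $$ (p i, j) =
        (if j div n = Suc (2 * (i div n)) then A (j div n) $$ (i mod n, j mod n) else 0)"
      if "i < ?l" "j < 2 * h * n" for i j
    proof -
      have n: "n > 0" using that by (cases n) auto
      have "p i < (2 * h - 1) * n"
        using even_index_less[OF that(1)] that(1) by (simp add: p_def diff_mult_distrib)
      then have "?C $$ (p i, j) =
          (if j div n = Suc (p i div n) then A (j div n) $$ (p i mod n, j mod n) else 0)"
        using h A B that by (intro index_gen_companion) auto
      then show ?thesis using n that by (simp add: p_def)
    qed
    \<comment> \<open>Even block \<open>2 * a\<close> is joined to odd block
      \<open>2 * b + 1\<close> only for \<open>a = b\<close>, so this corner is block
      diagonal.\<close>
    have P: "?C $$ (p i, p (?l + j)) = diag_block_mat ?As $$ (i, j)" if "i < ?l" "j < ?l" for i j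
    proof -
      have n: "n > 0" using that by (cases n) auto
      have "j div n < h" using that n by (simp add: div_less_iff_less_mult)
      have pj: "p (?l + j) div n = Suc (2 * (j div n))" "p (?l + j) mod n = j mod n"
        using n by (auto simp: p_def)
      have "diag_block_mat ?As $$ (i, j) =
          (if i div n = j div n then (?As ! (i div n)) $$ (i mod n, j mod n) else 0)"
        using that A by (intro index_diag_block_mat) auto
      then show ?thesis
        using that pl[of "?l + j"] row[of i "p (?l + j)"] \<open>j div n < h\<close> by (auto simp: pj)
    qed
    have Z: "?C $$ (p i, p j) = 0" if "i < ?l" "j < ?l" for i j
    proof -
      have n: "n > 0" using that by (cases n) auto
      have "even (p j div n)" using n that by (simp add: p_def)
      then have "p j div n \<noteq> Suc (2 * (i div n))" by auto
      then show ?thesis using that pl[of j] row[of i "p j"] by simp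
    qed
    show ?thesis
    proof (rule eq_matI)
      fix i j
      assume "i < dim_row (four_block_mat (0\<^sub>m ?l ?l) (diag_block_mat ?As) ?Q ?R)"
        "j < dim_col (four_block_mat (0\<^sub>m ?l ?l) (diag_block_mat ?As) ?Q ?R)"
      then have ij: "i < ?l + ?l" "j < ?l + ?l" using D by auto
      have "?C $$ (p i, p j) = ?C $$ (p (?l + (i - ?l)), p (?l + (j - ?l)))" if "\<not> i < ?l" "\<not> j < ?l"
        using that by simp
      moreover have "?C $$ (p i, p j) = diag_block_mat ?As $$ (i, j - ?l)" if "i < ?l" "\<not> j < ?l"
        using P[of i "j - ?l"] that ij by simp
      ultimately show "mat (2 * h * n) (2 * h * n) (\<lambda>(i, j). ?C $$ (p i, p j)) $$ (i, j) =
          four_block_mat (0\<^sub>m ?l ?l) (diag_block_mat ?As) ?Q ?R $$ (i, j)"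
        using ij Z D by auto
    qed (use D in auto)
  qed
  ultimately show "unitarily_similar ?C (four_block_mat (0\<^sub>m ?l ?l) (diag_block_mat ?As) ?Q ?R)"
    by simp
qed

theorem theorem3p5:
  fixes m n :: nat and A B :: "nat \<Rightarrow> complex mat"
  assumes "m \<ge> 2"
    and "\<And>j. 1 \<le> j \<Longrightarrow> j \<le> m - 1 \<Longrightarrow> A j \<in> carrier_mat n n"
    and "invertible_mat (diag_block_mat (map A [1..<m]))"
    and "\<And>j. j \<le> m - 1 \<Longrightarrow> B j \<in> carrier_mat n n"
  shows "(m \<ge> 3 \<and> odd m \<longrightarrow>
            (real m - 1) * real n / 2 \<le> real (zero_dilation_index (gen_companion m n A B)) \<and>
            real (zero_dilation_index (gen_companion m n A B)) \<le> (real m + 1) * real n / 2) \<and>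
         (even m \<longrightarrow>
            real (zero_dilation_index (gen_companion m n A B)) = real m * real n / 2)"
proof -
  note A = assms(2)
  have m: "m \<ge> 1" and B: "B 0 \<in> carrier_mat n n" using assms(1,4) by auto
  let ?C = "gen_companion m n A B" and ?D = "diag_block_mat (map A [1..<m])"
  have C: "?C \<in> carrier_mat (m * n) (m * n)" using gen_companion_carrier[of m A n B, OF m A] .
  have D: "?D \<in> carrier_mat ((m - 1) * n) ((m - 1) * n)"
    by (rule diag_block_mat_upt_carrier) (rule A)
  have detD: "det ?D \<noteq> 0" using invertible_mat_det_nonzero[OF assms(3)] .
  \<comment> \<open>Each \<open>det (A j)\<close> is a factor of the nonzero determinant of the
    direct sum.\<close>
  have detA: "det (A j) \<noteq> 0" if "1 \<le> j" "j \<le> m - 1" for j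
  proof -
    have "det ?D = (\<Prod>X\<leftarrow>map A [1..<m]. det X)" using A by (intro det_diag_block_mat[of _ n]) auto
    then have "0 \<notin> set (map det (map A [1..<m]))" using detD by (simp add: prod_list_zero_iff)
    moreover have "j \<in> set [1..<m]" using that by auto
    ultimately show ?thesis by force
  qed
  let ?d = "zero_dilation_index ?C"
  have lower: "m div 2 * n \<le> ?d"
    unfolding zero_dilation_index_def
    using has_zero_block_gen_companion[of m A n B, OF m A B] by (intro Max_ge finite_has_zero_block) simp
  \<comment> \<open>The maximum is attained, since the set is finite and contains 0.\<close>
  have zb: "has_zero_block ?C ?d"
    using Max_in[OF finite_has_zero_block[of ?C]] has_zero_block_0[OF C]
    unfolding zero_dilation_index_def by blast
  \<comment> \<open>A border of width \<open>n\<close> makes \<open>?C\<close> nonsingular for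
    \<open>m\<close> of either parity; half of the enlarged size is the bound claimed for odd
    \<open>m\<close>.\<close>
  have "2 * ?d \<le> (m + 1) * n"
  proof -
    have mn: "(m - 1) * n + n = m * n" using m by (cases m) auto
    have Br: "block_row n (map B [1..<m]) \<in> carrier_mat n ((m - 1) * n)" by (simp add: block_row_def)
    obtain E F where EF: "E \<in> carrier_mat (m * n) n" "F \<in> carrier_mat n (m * n)"
      "det (four_block_mat ?C E F (0\<^sub>m n n)) \<noteq> 0"
      using exists_nonsingular_bordering[OF D B Br detD] unfolding mn gen_companion_def by blast
    have "2 * ?d \<le> m * n + n"
      using has_zero_block_bordered[OF C zb EF(1,2)] C EF
      by (intro has_zero_block_det_nonzero[of "four_block_mat ?C E F (0\<^sub>m n n)"]) auto
    then show ?thesis by simp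
  qed
  then have odd_upper: "real ?d \<le> (real m + 1) * real n / 2"
    by (simp flip: of_nat_mult of_nat_add of_nat_Suc add: field_simps)
  have even_upper: "?d \<le> m div 2 * n" if ev: "even m"
  proof -
    obtain h where h: "m = 2 * h" using ev by blast
    have "h \<ge> 1" using m h by auto
    \<comment> \<open>Only the blocks \<open>A 1\<close>, \<open>A 3\<close>, ...,
      \<open>A (2 * h - 1)\<close> enter the corner, and each of them is nonsingular.\<close>
    let ?P = "diag_block_mat (map (\<lambda>q. A (Suc (2 * q))) [0..<h])"
    obtain Q R where QR: "Q \<in> carrier_mat (h * n) (h * n)" "R \<in> carrier_mat (h * n) (h * n)"
      "unitarily_similar ?C (four_block_mat (0\<^sub>m (h * n) (h * n)) ?P Q R)"
      using unitarily_similar_gen_companion[of h A n B] A B h \<open>h \<ge> 1\<close> by metis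
    have "det ?P = (\<Prod>X\<leftarrow>map (\<lambda>q. A (Suc (2 * q))) [0..<h]. det X)"
      using A h by (intro det_diag_block_mat[of _ n]) auto
    also have "\<dots> \<noteq> 0" using detA h by (auto simp: prod_list_zero_iff)
    finally have "det ?P \<noteq> 0" .
    moreover have "?P \<in> carrier_mat (h * n) (h * n)"
      using diag_block_mat_carrier[of "map (\<lambda>q. A (Suc (2 * q))) [0..<h]" n] A h by fastforce
    ultimately have "?d \<le> h * n"
      using C QR zb h by (intro has_zero_block_le_half[of ?C "h * n" ?P Q R]) (auto simp: mult.assoc)
    then show ?thesis using h by simp
  qed
  have "(real m - 1) * real n / 2 \<le> real ?d" if od: "odd m"
  proof -
    obtain h where h: "m = 2 * h + 1" using od by (rule oddE)
    then have "real (h * n) \<le> real ?d" using lower by (intro of_nat_mono) simp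
    then show ?thesis using h by simp
  qed
  moreover have "real ?d = real m * real n / 2" if ev: "even m"
  proof -
    obtain h where h: "m = 2 * h" using ev by blast
    then have "?d = h * n" using lower even_upper[OF ev] by simp
    then show ?thesis using h by simp
  qed
  ultimately show ?thesis using odd_upper by blast
qed

end
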